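(* If $M$ is a noetherian gcd-monoid satisfying the $3$-Ore condition, then the rewrite systems $\mathcal{R}_M$ and $\widehat{\mathcal{R}}_M$ are convergent.
   Context: For $a,b$ in a monoid $M$: $a$ left divides $b$ (and $b$ is a right multiple of $a$) if $b=ax$ for some $x$; $a$ right divides $b$ (and $b$ is a left multiple of $a$) if $b=xa$ for some $x$. A gcd-monoid is a cancellative monoid with no nontrivial invertible element in which any two elements admit a left gcd and a right gcd. In a gcd-monoid, two elements with a common right (resp. left) multiple have a unique right lcm $a\vee b$ (resp. left lcm $a\mathbin{\tilde\vee} b$). $M$ is noetherian if the proper left and the proper right divisibility relations are both well-founded. $3$-Ore condition: any three elements of $M$ that pairwise admit a common right (resp. left) multiple admit a global common right (resp. left) multiple (both versions are required). A multifraction on $M$ is a finite sequence $\underline a = a_1/\cdots/a_n$ of elements of $M$; $n$ is its depth $\|\underline a\|$; $\varnothing$ is the empty sequence; $\mathcal F_M$ is the set of all multifractions. For $i\ge1$ and $x\in M$, one writes $\underline b=\underline a\bullet R_{i,x}$ if $\|\underline b\|=\|\underline a\|>i$, $b_k=a_k$ for $k\ne i-1,i,i+1$, and there is $x'\in M$ with: - $i$ even: $b_{i-1}=a_{i-1}x'$, $xb_i=a_ix'=x\vee a_i$, $xb_{i+1}=a_{i+1}$; - $i\ge3$ odd: $b_{i-1}=x'a_{i-1}$, $b_ix=x'a_i=x\mathbin{\tilde\vee}a_i$, $b_{i+1}x=a_{i+1}$; - $i=1$: $b_1x=a_1$, $b_2x=a_2$. The rewrite system $\mathcal R_M$ on $\mathcal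 F_M$ is given by $\underline a\Rightarrow\underline b$ iff $\underline b=\underline a\bullet R_{i,x}$ for some $i$ and some $x\ne1$. The system $\widehat{\mathcal R}_M$ has in addition the rule $R_\times$ that removes the last entry of a multifraction when this entry is $1$. A rewrite system is convergent if every element (multifraction) reduces, by finitely many rewriting steps, to a unique irreducible element, and every sequence of rewriting steps leads to it in finitely many steps. *)

theory Defs
  imports Main
begin

text \<open>The monoid is the whole type \<open>'a\<close>, not assumed commutative.\<close>

context times
begin

definition left_dvd :: "'a \<Rightarrow> 'a \<Rightarrow> bool" where
  "left_dvd a b \<longleftrightarrow> (\<exists>x. b = a * x)"

definition right_dvd :: "'a \<Rightarrow> 'a \<Rightarrow> bool" where
  "right_dvd a b \<longleftrightarrow> (\<exists>x. b = x * a)"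

definition is_left_gcd :: "'a \<Rightarrow> 'a \<Rightarrow> 'a \<Rightarrow> bool" where
  "is_left_gcd a b d \<longleftrightarrow>
     left_dvd d a \<and> left_dvd d b \<and> (\<forall>e. left_dvd e a \<and> left_dvd e b \<longrightarrow> left_dvd e d)"

definition is_right_gcd :: "'a \<Rightarrow> 'a \<Rightarrow> 'a \<Rightarrow> bool" where
  "is_right_gcd a b d \<longleftrightarrow>
     right_dvd d a \<and> right_dvd d b \<and> (\<forall>e. right_dvd e a \<and> right_dvd e b \<longrightarrow> right_dvd e d)"

text \<open>A right lcm is a least common \<^emph>\<open>right multiple\<close>, hence least for \<^emph>\<open>left\<close> divisibility;
  symmetrically for left lcms.\<close>

definition is_right_lcm :: "'a \<Rightarrow> 'a \<Rightarrow> 'a \<Rightarrow> bool" where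
  "is_right_lcm a b m \<longleftrightarrow>
     left_dvd a m \<and> left_dvd b m \<and> (\<forall>e. left_dvd a e \<and> left_dvd b e \<longrightarrow> left_dvd m e)"

definition is_left_lcm :: "'a \<Rightarrow> 'a \<Rightarrow> 'a \<Rightarrow> bool" where
  "is_left_lcm a b m \<longleftrightarrow>
     right_dvd a m \<and> right_dvd b m \<and> (\<forall>e. right_dvd a e \<and> right_dvd b e \<longrightarrow> right_dvd m e)"

end

class gcd_monoid = monoid_mult +
  assumes mult_left_cancel: "a * b = a * c \<Longrightarrow> b = c"
    and mult_right_cancel: "b * a = c * a \<Longrightarrow> b = c"
    and no_nontrivial_unit: "a * b = 1 \<Longrightarrow> b * a = 1 \<Longrightarrow> a = 1"
    and ex_left_gcd: "\<exists>d. is_left_gcd a b d"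
    and ex_right_gcd: "\<exists>d. is_right_gcd a b d"

definition noetherian :: "'a::monoid_mult itself \<Rightarrow> bool" where
  "noetherian _ \<longleftrightarrow>
     wfp (\<lambda>a b :: 'a. left_dvd a b \<and> a \<noteq> b) \<and> wfp (\<lambda>a b :: 'a. right_dvd a b \<and> a \<noteq> b)"

definition three_ore :: "'a::monoid_mult itself \<Rightarrow> bool" where
  "three_ore _ \<longleftrightarrow>
     (\<forall>a b c :: 'a.
        (\<exists>m. left_dvd a m \<and> left_dvd b m) \<and>
        (\<exists>m. left_dvd b m \<and> left_dvd c m) \<and>
        (\<exists>m. left_dvd a m \<and> left_dvd c m)
        \<longrightarrow> (\<exists>m. left_dvd a m \<and> left_dvd b m \<and> left_dvd c m)) \<and>
     (\<forall>a b c :: 'a.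
        (\<exists>m. right_dvd a m \<and> right_dvd b m) \<and>
        (\<exists>m. right_dvd b m \<and> right_dvd c m) \<and>
        (\<exists>m. right_dvd a m \<and> right_dvd c m)
        \<longrightarrow> (\<exists>m. right_dvd a m \<and> right_dvd b m \<and> right_dvd c m))"

type_synonym 'a multifraction = "'a list"

text \<open>Entries of a multifraction are numbered from 1; \<open>entry a k\<close> is meaningful
  for \<open>1 \<le> k \<le> length a\<close> only.\<close>

definition entry :: "'a multifraction \<Rightarrow> nat \<Rightarrow> 'a" where
  "entry a k = a ! (k - 1)"

text \<open>\<open>reduct i x a b\<close> stands for \<open>b = a \<bullet> R\<^bsub>i,x\<^esub>\<close>. Lcms need not exist: the rule applies only
  when the lcm it mentions does.\<close>

definition reduct :: "nat \<Rightarrow> 'a::monoid_mult \<Rightarrow> 'a multifraction \<Rightarrow> 'a multifraction \<Rightarrow> bool" where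
  "reduct i x a b \<longleftrightarrow>
     1 \<le> i \<and> length b = length a \<and> i < length a \<and>
     (\<forall>k\<in>{1..length a}. k \<notin> {i - 1, i, i + 1} \<longrightarrow> entry b k = entry a k) \<and>
     (if i = 1 then
        entry b 1 * x = entry a 1 \<and> entry b 2 * x = entry a 2
      else if even i then
        (\<exists>x'. entry b (i - 1) = entry a (i - 1) * x' \<and>
              x * entry b i = entry a i * x' \<and> is_right_lcm x (entry a i) (entry a i * x') \<and>
              x * entry b (i + 1) = entry a (i + 1))
      else
        (\<exists>x'. entry b (i - 1) = x' * entry a (i - 1) \<and>
              entry b i * x = x' * entry a i \<and> is_left_lcm x (entry a i) (x' * entry a i) \<and>
              entry b (i + 1) * x = entry a (i + 1)))"

definition R_sys :: "'a::monoid_mult multifraction \<Rightarrow> 'a multifraction \<Rightarrow> bool" where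
  "R_sys a b \<longleftrightarrow> (\<exists>i x. x \<noteq> 1 \<and> reduct i x a b)"

definition R_hat_sys :: "'a::monoid_mult multifraction \<Rightarrow> 'a multifraction \<Rightarrow> bool" where
  "R_hat_sys a b \<longleftrightarrow> R_sys a b \<or> a = b @ [1]"

definition irreducible_for :: "('b \<Rightarrow> 'b \<Rightarrow> bool) \<Rightarrow> 'b \<Rightarrow> bool" where
  "irreducible_for r a \<longleftrightarrow> \<not> (\<exists>b. r a b)"

text \<open>Every maximal sequence of steps from \<open>a\<close> reaches the unique irreducible reduct of \<open>a\<close>
  after finitely many steps iff there is no infinite sequence of steps from \<open>a\<close>.\<close>

definition convergent_system :: "('b \<Rightarrow> 'b \<Rightarrow> bool) \<Rightarrow> bool" where
  "convergent_system r \<longleftrightarrow>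
     (\<forall>a. (\<exists>!b. r\<^sup>*\<^sup>* a b \<and> irreducible_for r b) \<and>
          \<not> (\<exists>s :: nat \<Rightarrow> 'b. s 0 = a \<and> (\<forall>n. r (s n) (s (Suc n)))))"

end

theory Submission
  imports Defs
begin

text \<open>Both systems terminate because a step shrinks the rightmost entry it touches, so by Newman's
  lemma local confluence suffices. Steps at levels differing by two or more commute. Two steps at
  adjacent levels \<open>i\<close> and \<open>i + 1\<close> are joined after at most one extra step at level \<open>i - 1\<close>, and this
  uses only that conditional lcms exist. Two steps \<open>R\<^bsub>i,x\<^esub>\<close>, \<open>R\<^bsub>i,y\<^esub>\<close> at the same level are joined in
  \<open>R\<^bsub>i,z\<^esub>\<close> with \<open>z\<close> the lcm of \<open>x\<close> and \<open>y\<close>: entry \<open>i + 1\<close> is a common multiple of \<open>x\<close> and \<open>y\<close>, so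
  \<open>x\<close>, \<open>y\<close> and entry \<open>i\<close> pairwise admit common multiples and the 3-Ore condition provides the lcm
  of \<open>z\<close> and entry \<open>i\<close>. Removing a final 1 commutes with all steps.\<close>

section \<open>Lcms in gcd-monoids\<close>

text \<open>Conditional lcms stand in for noetherianity, and the 3-Ore condition is stated for right
  multiples, so that the class can be instantiated with the product and with its opposite
  alike.\<close>

class three_ore_gcd_monoid = gcd_monoid +
  assumes ex_right_lcm: "left_dvd a m \<Longrightarrow> left_dvd b m \<Longrightarrow> \<exists>l. is_right_lcm a b l"
    and ex_left_lcm: "right_dvd a m \<Longrightarrow> right_dvd b m \<Longrightarrow> \<exists>l. is_left_lcm a b l"
    and right_three_ore: "left_dvd a l \<Longrightarrow> left_dvd b l \<Longrightarrow>
      left_dvd b m \<Longrightarrow> left_dvd c m \<Longrightarrow>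
      left_dvd a n \<Longrightarrow> left_dvd c n \<Longrightarrow>
      \<exists>k. left_dvd a k \<and> left_dvd b k \<and> left_dvd c k"

context gcd_monoid
begin

lemma left_unit_eq_one: "a * b = 1 \<Longrightarrow> a = 1"
proof -
  assume ab: "a * b = 1"
  then have "b * a * b = 1 * b" by (simp add: mult.assoc)
  then have "b * a = 1" by (rule mult_right_cancel)
  with ab show ?thesis by (rule no_nontrivial_unit)
qed

lemma right_unit_eq_one: "a * b = 1 \<Longrightarrow> b = 1"
  by (metis left_unit_eq_one mult_1_left)

lemma left_dvd_trans: "left_dvd a b \<Longrightarrow> left_dvd b c \<Longrightarrow> left_dvd a c"
  unfolding left_dvd_def by (metis mult.assoc)

lemma left_dvd_antisym: "left_dvd a b \<Longrightarrow> left_dvd b a \<Longrightarrow> a = b"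
  unfolding left_dvd_def
  by (metis left_unit_eq_one mult.assoc mult_left_cancel mult_1_right)

lemma left_dvd_mult_cancel: "left_dvd (a * b) (a * c) \<longleftrightarrow> left_dvd b c"
proof
  assume "left_dvd (a * b) (a * c)"
  then obtain x where "a * c = a * (b * x)" unfolding left_dvd_def by (auto simp: mult.assoc)
  then have "c = b * x" by (rule mult_left_cancel)
  then show "left_dvd b c" unfolding left_dvd_def by blast
qed (auto simp: left_dvd_def mult.assoc)

lemma left_dvd_triv [simp]: "left_dvd a (a * b)"
  unfolding left_dvd_def by blast

lemma right_dvd_triv [simp]: "right_dvd a (b * a)"
  unfolding right_dvd_def by blast

text \<open>A minimal common right multiple divides every other one, because the left gcd of two
  common right multiples is again a common right multiple.\<close>

lemma ex_right_lcm_if_wfp: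
  assumes "wfp (\<lambda>a b. left_dvd a b \<and> a \<noteq> b)" and "left_dvd a m" and "left_dvd b m"
  shows "\<exists>l. is_right_lcm a b l"
proof -
  have "\<exists>l\<in>{m. left_dvd a m \<and> left_dvd b m}. \<forall>k. left_dvd k l \<and> k \<noteq> l \<longrightarrow>
      k \<notin> {m. left_dvd a m \<and> left_dvd b m}"
    using assms(2,3) by (intro assms(1)[unfolded wfp_iff_ex_minimal, rule_format]) blast
  then obtain l where l: "left_dvd a l" "left_dvd b l"
    and min: "\<And>k. left_dvd k l \<Longrightarrow> k \<noteq> l \<Longrightarrow> left_dvd a k \<Longrightarrow> left_dvd b k \<Longrightarrow> False"
    by blast
  have "left_dvd l e" if e: "left_dvd a e" "left_dvd b e" for e
  proof -
    obtain d where "is_left_gcd l e d" using ex_left_gcd by blast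
    then have "left_dvd d l" "left_dvd d e" "left_dvd a d" "left_dvd b d"
      using l e unfolding is_left_gcd_def by auto
    then show ?thesis using min[of d] by blast
  qed
  then show ?thesis using l unfolding is_right_lcm_def by blast
qed

lemma is_right_lcm_of_left_dvd: "left_dvd a b \<Longrightarrow> is_right_lcm a b b"
  unfolding is_right_lcm_def left_dvd_def by (metis mult_1_right)

lemma is_right_lcm_unique: "is_right_lcm a b l \<Longrightarrow> is_right_lcm a b k \<Longrightarrow> l = k"
  unfolding is_right_lcm_def by (blast intro: left_dvd_antisym)

text \<open>Reducing by \<open>x * u\<close> amounts to reducing by \<open>x\<close> and then by
  \<open>u\<close>. If \<open>e\<close> is a common right multiple of \<open>u\<close> and
  \<open>r\<close>, then \<open>x * e\<close> is one of \<open>x * u\<close> and \<open>q\<close>;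
  cancel \<open>x\<close> in the resulting divisibility.\<close>

lemma is_right_lcm_quotient:
  assumes "is_right_lcm (x * u) q (q * (x' * u'))" and "x * r = q * x'"
  shows "is_right_lcm u r (r * u')"
proof -
  have eq: "x * (r * u') = q * (x' * u')" using assms(2) by (metis mult.assoc)
  show ?thesis
    unfolding is_right_lcm_def
  proof (intro conjI allI impI)
    show "left_dvd u (r * u')"
      using assms(1) left_dvd_mult_cancel unfolding is_right_lcm_def eq[symmetric] by blast
    fix e assume "left_dvd u e \<and> left_dvd r e"
    then have "left_dvd (x * u) (x * e)" "left_dvd (x * r) (x * e)"
      by (simp_all add: left_dvd_mult_cancel)
    then have "left_dvd (x * u) (x * e)" "left_dvd q (x * e)"
      unfolding assms(2) by (auto intro: left_dvd_trans[OF left_dvd_triv])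
    then have "left_dvd (x * (r * u')) (x * e)"
      using assms(1) unfolding is_right_lcm_def eq by blast
    then show "left_dvd (r * u') e" by (simp add: left_dvd_mult_cancel)
  qed simp
qed

end

section \<open>Joining two steps: computations with the entries involved\<close>

context three_ore_gcd_monoid
begin

text \<open>\<open>q\<close> and \<open>r\<close> stand for entries \<open>i\<close> and
  \<open>i + 1\<close>. With \<open>z = x * u = y * v\<close> the right lcm of \<open>x\<close> and
  \<open>y\<close>, reducing by \<open>x\<close> then \<open>u\<close>, or by \<open>y\<close> then
  \<open>v\<close>, is reducing by \<open>z\<close>. The last conclusion serves level 1, where
  cofactors must be 1.\<close>

lemma join_same_level:
  assumes x: "x * q1 = q * x'" "is_right_lcm x q (q * x')" "x * r1 = r"
    and y: "y * q2 = q * y'" "is_right_lcm y q (q * y')" "y * r2 = r"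
  obtains u v u' v' q3 r3 where
    "u * q3 = q1 * u'" "is_right_lcm u q1 (q1 * u')" "u * r3 = r1"
    "v * q3 = q2 * v'" "is_right_lcm v q2 (q2 * v')" "v * r3 = r2"
    "x' * u' = y' * v'" "x' = 1 \<Longrightarrow> y' = 1 \<Longrightarrow> u' = 1 \<and> v' = 1"
proof -
  have xr: "left_dvd x r" "left_dvd y r"
    using x(3) y(3) by (metis left_dvd_triv)+
  then obtain z where z: "is_right_lcm x y z" using ex_right_lcm by blast
  then obtain u v where u: "z = x * u" and v: "z = y * v"
    unfolding is_right_lcm_def left_dvd_def by blast
  obtain r3 where r3: "r = z * r3"
    using z xr unfolding is_right_lcm_def left_dvd_def by blast
  have dv: "left_dvd x (q * x')" "left_dvd y (q * y')"
    using x(2) y(2) unfolding is_right_lcm_def by auto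
  \<comment> \<open>The pairwise common multiples are \<open>r\<close> for \<open>x\<close> and
    \<open>y\<close>, \<open>q * y'\<close> for \<open>y\<close> and \<open>q\<close>, and
    \<open>q * x'\<close> for \<open>x\<close> and \<open>q\<close>.\<close>
  obtain k where k: "left_dvd x k" "left_dvd y k" "left_dvd q k"
    using right_three_ore[OF xr dv(2) left_dvd_triv dv(1) left_dvd_triv] by blast
  then have "left_dvd z k" using z unfolding is_right_lcm_def by blast
  with k obtain l where l: "is_right_lcm z q l" using ex_right_lcm by blast
  then obtain z' q3 where z': "l = q * z'" and q3: "l = z * q3"
    unfolding is_right_lcm_def left_dvd_def by blast
  have "left_dvd x l" "left_dvd y l"
    unfolding q3 using u v by (metis left_dvd_triv mult.assoc)+
  moreover have "left_dvd q l" unfolding z' by (rule left_dvd_triv)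
  ultimately have "left_dvd (q * x') (q * z')" "left_dvd (q * y') (q * z')"
    using x(2) y(2) z' unfolding is_right_lcm_def by auto
  then obtain u' v' where u': "z' = x' * u'" and v': "z' = y' * v'"
    unfolding left_dvd_mult_cancel unfolding left_dvd_def by blast
  have "x * (u * q3) = x * (q1 * u')" "y * (v * q3) = y * (q2 * v')"
    using x(1) y(1) u v u' v' z' q3 by (metis mult.assoc)+
  moreover have "x * (u * r3) = x * r1" "y * (v * r3) = y * r2"
    using x(3) y(3) u v r3 by (metis mult.assoc)+
  moreover have "is_right_lcm u q1 (q1 * u')" "is_right_lcm v q2 (q2 * v')"
    using is_right_lcm_quotient[OF _ x(1), of u u'] is_right_lcm_quotient[OF _ y(1), of v v']
      l[unfolded z'] by (simp_all only: u[symmetric] v[symmetric] u'[symmetric] v'[symmetric])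
  moreover have "u' = 1 \<and> v' = 1" if "x' = 1" "y' = 1"
  proof -
    have "left_dvd x q" "left_dvd y q" using dv that by simp_all
    then have "left_dvd z q" using z unfolding is_right_lcm_def by blast
    then have "l = q" using l is_right_lcm_of_left_dvd is_right_lcm_unique by blast
    then have "q * z' = q * 1" using z' by simp
    then have "z' = 1" by (rule mult_left_cancel)
    then show ?thesis using that u' v' by simp
  qed
  ultimately show ?thesis
    using that[of u q3 u' r3 v v'] u' v' mult_left_cancel by blast
qed

text \<open>Here the lcm of \<open>w\<close> and \<open>y' a2\<close> may be a proper divisor of \<open>y' a2 x'\<close>; the cofactor
  \<open>s\<close> is what a further reduction at the level below has to remove.\<close>

lemma join_adjacent_levels:
  assumes x: "x * b2 = a2 * x'" "x * b3 = a3"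
    and y: "c3 * y = y' * a3"
  obtains y'' d3 w z s e2 where
    "d3 * y = y'' * b3" "is_left_lcm y b3 (y'' * b3)"
    "w * e2 = y' * a2 * z" "is_right_lcm w (y' * a2) (y' * a2 * z)" "w * d3 = c3"
    "x' = z * s" "e2 * s = y'' * b2"
proof -
  \<comment> \<open>\<open>y' * a3\<close> is both \<open>c3 * y\<close> and
    \<open>y' * x * b3\<close>; its quotient \<open>w\<close> by the left lcm of \<open>y\<close>
    and \<open>b3\<close> is the factor still to be removed from \<open>c3\<close>.\<close>
  have "right_dvd y (y' * a3)" "right_dvd b3 (y' * a3)"
    using x(2) y by (metis right_dvd_triv mult.assoc)+
  then obtain l where l: "is_left_lcm y b3 l" and "right_dvd l (y' * a3)"
    using ex_left_lcm unfolding is_left_lcm_def by metis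
  then obtain y'' d3 w where l': "l = y'' * b3" "l = d3 * y" and w: "y' * a3 = w * l"
    unfolding is_left_lcm_def right_dvd_def by metis
  have "y' * x * b3 = w * y'' * b3" using w l' x(2) by (simp add: mult.assoc)
  then have yx: "y' * x = w * y''" by (rule mult_right_cancel)
  have "c3 * y = w * d3 * y" using w l' y by (simp add: mult.assoc)
  then have c3: "c3 = w * d3" by (rule mult_right_cancel)
  \<comment> \<open>This is a common right multiple of \<open>w\<close> and \<open>y' * a2\<close>,
    so their right lcm exists.\<close>
  have m: "y' * a2 * x' = w * (y'' * b2)" using x(1) yx by (metis mult.assoc)
  then have "left_dvd w (y' * a2 * x')" by (metis left_dvd_triv)
  moreover have "left_dvd (y' * a2) (y' * a2 * x')" by (rule left_dvd_triv)
  ultimately obtain k where k: "is_right_lcm w (y' * a2) k" and "left_dvd k (y' * a2 * x')"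
    using ex_right_lcm unfolding is_right_lcm_def by metis
  then obtain z e2 s where k': "k = y' * a2 * z" "k = w * e2" and s: "y' * a2 * x' = k * s"
    unfolding is_right_lcm_def left_dvd_def by metis
  have "y' * a2 * x' = y' * a2 * (z * s)" using s k' by (simp add: mult.assoc)
  then have "x' = z * s" by (rule mult_left_cancel)
  moreover have "w * (y'' * b2) = w * (e2 * s)" using s k'(2) m by (simp add: mult.assoc)
  then have "y'' * b2 = e2 * s" by (rule mult_left_cancel)
  ultimately show ?thesis
    using that[of d3 y'' w e2 z s] l l' k k' c3 by simp
qed

end

section \<open>Orientation of the product\<close>

text \<open>Reduction at an odd level is reduction at an even level in the opposite monoid, so both are
  treated at once by letting the parity of the level choose the product; for \<open>e = False\<close> the
  oriented right lcm is the left lcm.\<close>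

definition oriented_mult :: "bool \<Rightarrow> 'a::times \<Rightarrow> 'a \<Rightarrow> 'a" where
  "oriented_mult e a b = (if e then a * b else b * a)"

abbreviation oriented_lcm :: "bool \<Rightarrow> 'a::times \<Rightarrow> 'a \<Rightarrow> 'a \<Rightarrow> bool" where
  "oriented_lcm e \<equiv> times.is_right_lcm (oriented_mult e)"

lemma oriented_left_dvd:
  "times.left_dvd (oriented_mult e) = (if e then left_dvd else right_dvd)"
  by (auto simp: fun_eq_iff times.left_dvd_def left_dvd_def right_dvd_def oriented_mult_def)

lemma oriented_right_dvd:
  "times.right_dvd (oriented_mult e) = (if e then right_dvd else left_dvd)"
  by (auto simp: fun_eq_iff times.right_dvd_def left_dvd_def right_dvd_def oriented_mult_def)

lemma oriented_right_lcm: "oriented_lcm e = (if e then is_right_lcm else is_left_lcm)"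
  by (auto simp: fun_eq_iff times.is_right_lcm_def oriented_left_dvd is_right_lcm_def is_left_lcm_def)

lemma oriented_left_lcm: "times.is_left_lcm (oriented_mult e) = oriented_lcm (\<not> e)"
  by (auto simp: fun_eq_iff times.is_left_lcm_def times.is_right_lcm_def
      oriented_left_dvd oriented_right_dvd)

lemma oriented_mult_not: "oriented_mult (\<not> e) a b = oriented_mult e b a"
  by (simp add: oriented_mult_def)

lemma oriented_gcd_monoid: "class.gcd_monoid (1::'a::gcd_monoid) (oriented_mult e)"
proof unfold_locales
  fix a b c :: 'a
  show "oriented_mult e (oriented_mult e a b) c = oriented_mult e a (oriented_mult e b c)"
    by (simp add: oriented_mult_def mult.assoc)
  show "oriented_mult e 1 a = a" "oriented_mult e a 1 = a"
    by (simp_all add: oriented_mult_def)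
  show "oriented_mult e a b = oriented_mult e a c \<Longrightarrow> b = c"
    "oriented_mult e b a = oriented_mult e c a \<Longrightarrow> b = c"
    by (auto simp: oriented_mult_def split: if_splits dest: mult_left_cancel mult_right_cancel)
  show "oriented_mult e a b = 1 \<Longrightarrow> oriented_mult e b a = 1 \<Longrightarrow> a = 1"
    by (auto simp: oriented_mult_def split: if_splits dest: no_nontrivial_unit)
  show "\<exists>d. times.is_left_gcd (oriented_mult e) a b d"
    using ex_left_gcd[of a b] ex_right_gcd[of a b]
    by (simp add: times.is_left_gcd_def oriented_left_dvd is_left_gcd_def is_right_gcd_def)
  show "\<exists>d. times.is_right_gcd (oriented_mult e) a b d"
    using ex_left_gcd[of a b] ex_right_gcd[of a b]
    by (simp add: times.is_right_gcd_def oriented_right_dvd is_left_gcd_def is_right_gcd_def)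
qed

text \<open>The orientation selects the half of the 3-Ore condition. Lcms are needed for both
  orientations, as left lcms for \<open>e\<close> are right lcms for \<open>\<not> e\<close>; each
  kind comes from well-foundedness of the matching divisibility.\<close>

lemma oriented_three_ore_gcd_monoid:
  assumes noeth: "noetherian TYPE('a::gcd_monoid)" and ore: "three_ore TYPE('a)"
  shows "class.three_ore_gcd_monoid (1::'a) (oriented_mult e)"
proof -
  have left_wf: "wfp (\<lambda>a b. times.left_dvd (oriented_mult f) a b \<and> a \<noteq> (b :: 'a))" for f
    using noeth unfolding noetherian_def oriented_left_dvd by simp
  have lcm: "\<exists>l. oriented_lcm f a b l"
    if "times.left_dvd (oriented_mult f) a m" "times.left_dvd (oriented_mult f) b m"
    for f and a b m :: 'a
    using gcd_monoid.ex_right_lcm_if_wfp[OF oriented_gcd_monoid left_wf that] .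
  show ?thesis
  proof (rule class.three_ore_gcd_monoid.intro[OF oriented_gcd_monoid], unfold_locales)
    fix a b m :: 'a
    show "times.left_dvd (oriented_mult e) a m \<Longrightarrow> times.left_dvd (oriented_mult e) b m \<Longrightarrow>
      \<exists>l. oriented_lcm e a b l"
      by (rule lcm)
    show "times.right_dvd (oriented_mult e) a m \<Longrightarrow> times.right_dvd (oriented_mult e) b m \<Longrightarrow>
      \<exists>l. times.is_left_lcm (oriented_mult e) a b l"
      using lcm[of "\<not> e" a m b] unfolding oriented_left_lcm oriented_left_dvd oriented_right_dvd
      by (cases e) simp_all
  next
    fix a b c l m n :: 'a
    assume *: "times.left_dvd (oriented_mult e) a l" "times.left_dvd (oriented_mult e) b l"
      "times.left_dvd (oriented_mult e) b m" "times.left_dvd (oriented_mult e) c m"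
      "times.left_dvd (oriented_mult e) a n" "times.left_dvd (oriented_mult e) c n"
    show "\<exists>k. times.left_dvd (oriented_mult e) a k \<and> times.left_dvd (oriented_mult e) b k \<and>
      times.left_dvd (oriented_mult e) c k"
    proof (cases e)
      case True
      then show ?thesis using * ore unfolding three_ore_def oriented_left_dvd by simp blast
    next
      case False
      then show ?thesis using * ore unfolding three_ore_def oriented_left_dvd by simp blast
    qed
  qed
qed

section \<open>Local confluence on sequences\<close>

text \<open>Position 0 is a dummy entry; level 1 becomes an ordinary odd level whose cofactor \<open>x'\<close>
  is forced to be 1.\<close>

definition seq_reduct ::
  "nat \<Rightarrow> nat \<Rightarrow> 'a::monoid_mult \<Rightarrow> (nat \<Rightarrow> 'a) \<Rightarrow> (nat \<Rightarrow> 'a) \<Rightarrow> bool" where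
  "seq_reduct n i x g h \<longleftrightarrow> 1 \<le> i \<and> i < n \<and>
     (\<exists>x' q r. (i = 1 \<longrightarrow> x' = 1) \<and>
        oriented_mult (even i) x q = oriented_mult (even i) (g i) x' \<and>
        oriented_lcm (even i) x (g i) (oriented_mult (even i) (g i) x') \<and>
        oriented_mult (even i) x r = g (i + 1) \<and>
        h = g(i - 1 := oriented_mult (even i) (g (i - 1)) x', i := q, i + 1 := r))"

lemma seq_reductI:
  assumes "1 \<le> i" "i < n" "i = 1 \<Longrightarrow> x' = 1" and "even i = e"
    and "oriented_mult e x q = oriented_mult e (g i) x'"
    and "oriented_lcm e x (g i) (oriented_mult e (g i) x')"
    and "oriented_mult e x r = g (i + 1)"
    and "h = g(i - 1 := oriented_mult e (g (i - 1)) x', i := q, i + 1 := r)"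
  shows "seq_reduct n i x g h"
  using assms unfolding seq_reduct_def by blast

definition seq_joinable :: "nat \<Rightarrow> (nat \<Rightarrow> 'a::monoid_mult) \<Rightarrow> (nat \<Rightarrow> 'a) \<Rightarrow> bool" where
  "seq_joinable n g h \<longleftrightarrow> (\<exists>k. (\<lambda>g h. \<exists>i x. seq_reduct n i x g h)\<^sup>*\<^sup>* g k \<and>
     (\<lambda>g h. \<exists>i x. seq_reduct n i x g h)\<^sup>*\<^sup>* h k)"

lemma seq_joinable_sym: "seq_joinable n g h \<Longrightarrow> seq_joinable n h g"
  unfolding seq_joinable_def by blast

lemma seq_joinable_step:
  assumes "seq_reduct n i x g k" "seq_reduct n j y h k"
  shows "seq_joinable n g h"
  using assms unfolding seq_joinable_def by (blast intro: r_into_rtranclp)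

lemma oriented_mult_assoc:
  fixes a :: "'a::monoid_mult"
  shows "oriented_mult e (oriented_mult e a b) c = oriented_mult e a (oriented_mult e b c)"
  by (simp add: oriented_mult_def mult.assoc)

lemma oriented_mult_1 [simp]:
  fixes a :: "'a::monoid_mult"
  shows "oriented_mult e a 1 = a" "oriented_mult e 1 a = a"
  by (simp_all add: oriented_mult_def)

lemma fun_upd_triple_commute:
  assumes "{a, b, c} \<inter> {a', b', c'} = {}"
  shows "f(a' := x', b' := y', c' := z', a := x, b := y, c := z)
    = f(a := x, b := y, c := z, a' := x', b' := y', c' := z')"
  using assms by (auto simp: fun_eq_iff)

section \<open>Equal, adjacent and distant levels\<close>

context
  assumes noeth: "noetherian TYPE('a::gcd_monoid)" and ore: "three_ore TYPE('a)"
begin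

lemma seq_joinable_same_level:
  fixes g :: "nat \<Rightarrow> 'a"
  assumes 1: "seq_reduct n i x g g1" and 2: "seq_reduct n i y g g2"
  shows "seq_joinable n g1 g2"
proof -
  let ?m = "oriented_mult (even i)"
  obtain x' q1 r1 where x: "i = 1 \<longrightarrow> x' = 1" "?m x q1 = ?m (g i) x'"
    "oriented_lcm (even i) x (g i) (?m (g i) x')" "?m x r1 = g (i + 1)"
    and g1: "g1 = g(i - 1 := ?m (g (i - 1)) x', i := q1, i + 1 := r1)"
    using 1 unfolding seq_reduct_def by blast
  obtain y' q2 r2 where y: "i = 1 \<longrightarrow> y' = 1" "?m y q2 = ?m (g i) y'"
    "oriented_lcm (even i) y (g i) (?m (g i) y')" "?m y r2 = g (i + 1)"
    and g2: "g2 = g(i - 1 := ?m (g (i - 1)) y', i := q2, i + 1 := r2)"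
    using 2 unfolding seq_reduct_def by blast
  obtain u v u' v' q3 r3 where
    u: "?m u q3 = ?m q1 u'" "oriented_lcm (even i) u q1 (?m q1 u')" "?m u r3 = r1" and
    v: "?m v q3 = ?m q2 v'" "oriented_lcm (even i) v q2 (?m q2 v')" "?m v r3 = r2" and
    uv: "?m x' u' = ?m y' v'" "x' = 1 \<Longrightarrow> y' = 1 \<Longrightarrow> u' = 1 \<and> v' = 1"
    by (rule three_ore_gcd_monoid.join_same_level
        [OF oriented_three_ore_gcd_monoid[OF noeth ore] x(2-4) y(2-4)]) blast
  have i: "1 \<le> i" "i < n" using 1 unfolding seq_reduct_def by auto
  \<comment> \<open>The common target is the reduct by the lcm of \<open>x\<close> and
    \<open>y\<close>; the equality \<open>uv(1)\<close> makes entry \<open>i - 1\<close> agree on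
    both sides.\<close>
  let ?k = "g(i - 1 := ?m (g (i - 1)) (?m x' u'), i := q3, i + 1 := r3)"
  show ?thesis
  proof (rule seq_joinable_step)
    show "seq_reduct n i u g1 ?k"
    proof (rule seq_reductI[OF i _ refl])
      show "u' = 1" if "i = 1" using that x(1) y(1) uv(2) by blast
      show "?k = g1(i - 1 := ?m (g1 (i - 1)) u', i := q3, i + 1 := r3)"
        using i by (auto simp: g1 oriented_mult_assoc)
    qed (use u i in \<open>auto simp: g1\<close>)
    show "seq_reduct n i v g2 ?k"
    proof (rule seq_reductI[OF i _ refl])
      show "v' = 1" if "i = 1" using that x(1) y(1) uv(2) by blast
      show "?k = g2(i - 1 := ?m (g2 (i - 1)) v', i := q3, i + 1 := r3)"
        using i by (auto simp: g2 oriented_mult_assoc uv(1))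
    qed (use v i in \<open>auto simp: g2\<close>)
  qed
qed

text \<open>The step by \<open>y\<close> from \<open>g1\<close> gives \<open>h\<close>, and a step
  by \<open>w\<close> from \<open>g2\<close> gives \<open>k\<close>. In \<open>h\<close>, entries
  \<open>i - 1\<close> and \<open>i\<close> carry a factor \<open>s\<close> missing in
  \<open>k\<close>, which a step at level \<open>i - 1\<close> removes.\<close>

lemma seq_joinable_adjacent_levels:
  fixes g :: "nat \<Rightarrow> 'a"
  assumes 1: "seq_reduct n i x g g1" and 2: "seq_reduct n (i + 1) y g g2"
  shows "seq_joinable n g1 g2"
proof -
  define e where "e = even i"
  let ?m = "oriented_mult e"
  have e: "even i = e" "even (i + 1) = (\<not> e)" by (simp_all add: e_def)
  have i: "1 \<le> i" "i + 1 < n" using 1 2 unfolding seq_reduct_def by auto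
  obtain x' b2 b3 where x: "i = 1 \<longrightarrow> x' = 1" "?m x b2 = ?m (g i) x'" "?m x b3 = g (i + 1)"
    and g1: "g1 = g(i - 1 := ?m (g (i - 1)) x', i := b2, i + 1 := b3)"
    using 1 unfolding seq_reduct_def e by blast
  obtain y' c3 c4 where y: "?m c3 y = ?m y' (g (i + 1))" "?m c4 y = g (i + 1 + 1)"
    and "g2 = g(i + 1 - 1 := ?m y' (g (i + 1 - 1)), i + 1 := c3, i + 1 + 1 := c4)"
    using 2 unfolding seq_reduct_def e oriented_mult_not by blast
  then have g2: "g2 = g(i := ?m y' (g i), i + 1 := c3, i + 2 := c4)" by simp
  obtain y'' d3 w z s e2 where
    d: "?m d3 y = ?m y'' b3" "oriented_lcm (\<not> e) y b3 (?m y'' b3)" and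
    w: "?m w e2 = ?m (?m y' (g i)) z" "oriented_lcm e w (?m y' (g i)) (?m (?m y' (g i)) z)"
      "?m w d3 = c3" and
    s: "x' = ?m z s" "?m e2 s = ?m y'' b2"
    by (rule three_ore_gcd_monoid.join_adjacent_levels
        [OF oriented_three_ore_gcd_monoid[OF noeth ore] x(2,3) y(1), unfolded oriented_left_lcm])
  \<comment> \<open>At level 1 the cofactor \<open>x'\<close> is 1, and a product equal to 1 has
    trivial factors, so no step at level 0 is called for.\<close>
  have zs: "z = 1 \<and> s = 1" if "i = 1"
  proof -
    have "?m z s = 1" using that x(1) s(1) by simp
    then show ?thesis
      using gcd_monoid.left_unit_eq_one[OF oriented_gcd_monoid]
        gcd_monoid.right_unit_eq_one[OF oriented_gcd_monoid] by blast
  qed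
  define h where
    "h = g(i - 1 := ?m (g (i - 1)) x', i := ?m y'' b2, i + 1 := d3, i + 2 := c4)"
  define k where
    "k = g(i - 1 := ?m (g (i - 1)) z, i := e2, i + 1 := d3, i + 2 := c4)"
  have "seq_reduct n (i + 1) y g1 h"
  proof (rule seq_reductI[OF _ i(2) _ e(2)])
    show "h = g1(i + 1 - 1 := oriented_mult (\<not> e) (g1 (i + 1 - 1)) y'', i + 1 := d3,
        i + 1 + 1 := c4)"
      using i by (auto simp: g1 h_def oriented_mult_not)
  qed (use i d y in \<open>auto simp: g1 oriented_mult_not\<close>)
  moreover have "seq_reduct n i w g2 k"
  proof (rule seq_reductI[OF i(1) _ _ e(1)])
    show "z = 1" if "i = 1" using zs that by blast
    show "k = g2(i - 1 := ?m (g2 (i - 1)) z, i := e2, i + 1 := d3)"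
      using i by (auto simp: fun_eq_iff g2 k_def)
  qed (use i w in \<open>auto simp: g2\<close>)
  moreover have "h = k \<or> seq_reduct n (i - 1) s h k"
  proof (cases "i = 1")
    case True
    then have "z = 1" "x' = 1" "e2 = ?m y'' b2" using zs s x(1) by simp_all
    then have "h = k" by (simp add: h_def k_def)
    then show ?thesis ..
  next
    case False
    then have e': "even (i - 1) = (\<not> e)" using i by (simp add: e_def)
    have hi: "h (i - 1) = ?m (?m (g (i - 1)) z) s" "h i = ?m e2 s"
      using i by (auto simp: h_def s(1) s(2)[symmetric] oriented_mult_assoc)
    \<comment> \<open>As \<open>s\<close> already divides entry \<open>i - 1\<close>, the lcm is
      that entry and the cofactor passed to entry \<open>i - 2\<close> is 1, as level 1 would
      require.\<close>
    have "oriented_lcm (\<not> e) s (h (i - 1)) (h (i - 1))"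
      unfolding hi
      by (rule gcd_monoid.is_right_lcm_of_left_dvd[OF oriented_gcd_monoid])
        (auto simp: times.left_dvd_def oriented_mult_not)
    then have "seq_reduct n (i - 1) s h k"
    proof (intro seq_reductI[OF _ _ _ e'])
      show "k = h(i - 1 - 1 := oriented_mult (\<not> e) (h (i - 1 - 1)) 1,
          i - 1 := ?m (g (i - 1)) z, i - 1 + 1 := e2)"
        using i False by (auto simp: fun_eq_iff h_def k_def)
    qed (use i False hi in \<open>auto simp: oriented_mult_not\<close>)
    then show ?thesis ..
  qed
  ultimately show ?thesis
    unfolding seq_joinable_def
    by (blast intro: r_into_rtranclp rtranclp.rtrancl_into_rtrancl)
qed

text \<open>The modified positions meet only for \<open>j = i + 2\<close>, in position
  \<open>i + 1\<close>. There both levels have the same orientation, and one step divides on one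
  side while the other multiplies on the other side.\<close>

lemma seq_joinable_distant_levels:
  fixes g :: "nat \<Rightarrow> 'a"
  assumes 1: "seq_reduct n i x g g1" and 2: "seq_reduct n j y g g2" and ij: "i + 2 \<le> j"
  shows "seq_joinable n g1 g2"
proof -
  let ?m = "oriented_mult (even i)" and ?m' = "oriented_mult (even j)"
  obtain x' q1 r1 where x: "i = 1 \<longrightarrow> x' = 1" "?m x q1 = ?m (g i) x'"
    "oriented_lcm (even i) x (g i) (?m (g i) x')" "?m x r1 = g (i + 1)"
    and g1: "g1 = g(i - 1 := ?m (g (i - 1)) x', i := q1, i + 1 := r1)"
    using 1 unfolding seq_reduct_def by blast
  obtain y' q2 r2 where y: "?m' y q2 = ?m' (g j) y'"
    "oriented_lcm (even j) y (g j) (?m' (g j) y')" "?m' y r2 = g (j + 1)"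
    and g2: "g2 = g(j - 1 := ?m' (g (j - 1)) y', j := q2, j + 1 := r2)"
    using 2 unfolding seq_reduct_def by blast
  have i: "1 \<le> i" "i < n" "j < n" using 1 2 unfolding seq_reduct_def by auto
  define r where "r = (if j = i + 2 then ?m r1 y' else r1)"
  define k where "k = g1(j - 1 := ?m' (g1 (j - 1)) y', j := q2, j + 1 := r2)"
  have r: "?m x r = g2 (i + 1)"
  proof (cases "j = i + 2")
    case True
    then show ?thesis using x(4) by (simp add: r_def g2 oriented_mult_assoc[symmetric])
  next
    case False
    then have "i + 1 \<notin> {j - 1, j, j + 1}" using ij by auto
    then show ?thesis using False x(4) by (simp add: r_def g2)
  qed
  show ?thesis
  proof (rule seq_joinable_step)
    show "seq_reduct n j y g1 k"
    proof (rule seq_reductI[OF _ _ _ refl])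
      show "k = g1(j - 1 := ?m' (g1 (j - 1)) y', j := q2, j + 1 := r2)" by (simp add: k_def)
      have "g1 j = g j" "g1 (j + 1) = g (j + 1)" using i ij by (auto simp: g1)
      then show "?m' y q2 = ?m' (g1 j) y'" "oriented_lcm (even j) y (g1 j) (?m' (g1 j) y')"
        "?m' y r2 = g1 (j + 1)"
        using y by simp_all
    qed (use i ij in auto)
    have "k = g2(i - 1 := ?m (g2 (i - 1)) x', i := q1, i + 1 := r)"
    proof (cases "j = i + 2")
      case True
      moreover obtain p where "i = p + 1" using i(1) by (metis add.commute le_Suc_ex)
      ultimately show ?thesis by (auto simp: k_def g1 g2 r_def fun_eq_iff)
    next
      case False
      define A B where "A = ?m (g (i - 1)) x'" and "B = ?m' (g (j - 1)) y'"
      have "i + 1 < j - 1" "i - 1 < i" using i ij False by auto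
      then have g1j: "g1 (j - 1) = g (j - 1)" and g2i: "g2 (i - 1) = g (i - 1)"
        by (auto simp: g1 g2)
      have "r = r1" using False by (simp add: r_def)
      have "g2(i - 1 := ?m (g2 (i - 1)) x', i := q1, i + 1 := r)
          = g(j - 1 := B, j := q2, j + 1 := r2, i - 1 := A, i := q1, i + 1 := r1)"
        unfolding g2i \<open>r = r1\<close> unfolding g2 A_def B_def ..
      moreover have "\<dots> = g(i - 1 := A, i := q1, i + 1 := r1, j - 1 := B, j := q2, j + 1 := r2)"
        using \<open>i + 1 < j - 1\<close> by (intro fun_upd_triple_commute) auto
      moreover have "\<dots> = k" unfolding k_def g1j unfolding g1 A_def B_def ..
      ultimately show ?thesis by simp
    qed
    moreover have "g2 i = g i" using ij by (auto simp: g2)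
    ultimately show "seq_reduct n i x g2 k"
      using i(1,2) x(1-3) r by (intro seq_reductI[where x' = x' and q = q1 and r = r, OF _ _ _ refl]) simp_all
  qed
qed

lemma seq_locally_confluent:
  fixes g :: "nat \<Rightarrow> 'a"
  assumes "seq_reduct n i x g g1" "seq_reduct n j y g g2"
  shows "seq_joinable n g1 g2"
  using assms
proof (induction i j arbitrary: x y g1 g2 rule: linorder_wlog)
  case (le i j)
  consider "j = i" | "j = i + 1" | "i + 2 \<le> j" using le(1) by linarith
  then show ?case
    using le seq_joinable_same_level seq_joinable_adjacent_levels seq_joinable_distant_levels
    by cases blast+
next
  case (sym i j)
  then show ?case using seq_joinable_sym by blast
qed

end

text \<open>The lcm of 1 and an entry is that entry, so the cofactor is 1.\<close>

lemma seq_reduct_1: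
  fixes g :: "nat \<Rightarrow> 'a::gcd_monoid"
  assumes "seq_reduct n i 1 g h"
  shows "h = g"
proof -
  let ?m = "oriented_mult (even i)"
  obtain x' q r where x: "?m 1 q = ?m (g i) x'" "oriented_lcm (even i) 1 (g i) (?m (g i) x')"
    "?m 1 r = g (i + 1)" and h: "h = g(i - 1 := ?m (g (i - 1)) x', i := q, i + 1 := r)"
    using assms unfolding seq_reduct_def by blast
  have "oriented_lcm (even i) 1 (g i) (g i)"
    by (rule gcd_monoid.is_right_lcm_of_left_dvd[OF oriented_gcd_monoid])
      (simp add: times.left_dvd_def)
  then have "?m (g i) x' = ?m (g i) 1"
    using gcd_monoid.is_right_lcm_unique[OF oriented_gcd_monoid x(2)] by simp
  then have "x' = 1"
    by (rule gcd_monoid.mult_left_cancel[OF oriented_gcd_monoid])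
  then show ?thesis using x(1,3) h by simp
qed

section \<open>Multifractions as sequences\<close>

text \<open>The default 1 at position 0 is the dummy entry, which a step at level 1 preserves
  because its cofactor is 1.\<close>

definition entries :: "'a::monoid_mult multifraction \<Rightarrow> nat \<Rightarrow> 'a" where
  "entries a k = (if k \<in> {1..length a} then entry a k else 1)"

lemma entries_inject:
  assumes "length a = length b" "entries a = entries b"
  shows "a = b"
proof (rule nth_equalityI[OF assms(1)])
  fix k assume "k < length a"
  then show "a ! k = b ! k"
    using assms(1) fun_cong[OF assms(2), of "k + 1"] by (simp add: entries_def entry_def)
qed

lemma reduct_imp_seq_reduct:
  fixes a :: "'a::gcd_monoid multifraction"
  assumes "reduct i x a b"
  shows "length b = length a \<and> seq_reduct (length a) i x (entries a) (entries b)"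
proof -
  let ?m = "oriented_mult (even i)"
  have i: "1 \<le> i" "i < length a" and len: "length b = length a"
    and far: "\<And>k. k \<notin> {i - 1, i, i + 1} \<Longrightarrow> entries b k = entries a k"
    using assms by (auto simp: reduct_def entries_def)
  have ent: "entry c k = entries c k" if "k \<in> {i, i + 1}" "length c = length a" for c :: "'a list" and k
    using that i by (auto simp: entries_def)
  have "\<exists>x'. (i = 1 \<longrightarrow> x' = 1) \<and> entries b (i - 1) = ?m (entries a (i - 1)) x' \<and>
      ?m x (entries b i) = ?m (entries a i) x' \<and>
      oriented_lcm (even i) x (entries a i) (?m (entries a i) x') \<and>
      ?m x (entries b (i + 1)) = entries a (i + 1)"
  proof (cases "i = 1")
    case True
    then have *: "entries b 1 * x = entries a 1" "entries b 2 * x = entries a 2"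
      using assms i len by (auto simp: reduct_def entries_def)
    \<comment> \<open>The rule at level 1 mentions no lcm; since \<open>x\<close> right divides
      entry 1, the left lcm is entry 1 itself, with cofactor 1.\<close>
    then have "oriented_lcm False x (entries a 1) (entries a 1)"
      by (intro gcd_monoid.is_right_lcm_of_left_dvd[OF oriented_gcd_monoid])
        (metis oriented_left_dvd right_dvd_def)
    then show ?thesis
      using * True by (intro exI[of _ 1]) (simp add: oriented_mult_def entries_def numeral_2_eq_2)
  next
    case False
    then have "entry b (i - 1) = entries b (i - 1)" "entry a (i - 1) = entries a (i - 1)"
      using i len by (auto simp: entries_def)
    then show ?thesis
      using assms False len unfolding reduct_def oriented_right_lcm oriented_mult_def
      by (cases "even i") (auto simp: ent)
  qed
  then obtain x' where x': "i = 1 \<longrightarrow> x' = 1" "entries b (i - 1) = ?m (entries a (i - 1)) x'"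
      "?m x (entries b i) = ?m (entries a i) x'"
      "oriented_lcm (even i) x (entries a i) (?m (entries a i) x')"
      "?m x (entries b (i + 1)) = entries a (i + 1)"
    by blast
  moreover have "entries b = (entries a)(i - 1 := ?m (entries a (i - 1)) x', i := entries b i,
      i + 1 := entries b (i + 1))"
    using far x'(2) by (auto simp: fun_eq_iff)
  ultimately show ?thesis using i len unfolding seq_reduct_def by blast
qed

lemma seq_reduct_imp_reduct:
  fixes a :: "'a::gcd_monoid multifraction"
  assumes "seq_reduct (length a) i x (entries a) (entries b)" "length b = length a"
  shows "reduct i x a b"
proof -
  let ?m = "oriented_mult (even i)"
  obtain x' q r where i: "1 \<le> i" "i < length a" and x: "i = 1 \<longrightarrow> x' = 1"
    "?m x q = ?m (entries a i) x'"
    "oriented_lcm (even i) x (entries a i) (?m (entries a i) x')" "?m x r = entries a (i + 1)"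
    and b: "entries b = (entries a)(i - 1 := ?m (entries a (i - 1)) x', i := q, i + 1 := r)"
    using assms(1) unfolding seq_reduct_def by blast
  have ent: "entry c k = entries c k" if "k \<in> {1..length a}" "length c = length a"
    for c :: "'a list" and k
    using that by (auto simp: entries_def)
  have b': "entries b i = q" "entries b (i + 1) = r"
    "entries b (i - 1) = ?m (entries a (i - 1)) x'"
    using i by (auto simp: b)
  have far: "entry b k = entry a k" if "k \<in> {1..length a}" "k \<notin> {i - 1, i, i + 1}" for k
    using that assms(2) by (simp add: ent b)
  have near: "entry b i = q" "entry b (i + 1) = r" "entry a i = entries a i"
    "entry a (i + 1) = entries a (i + 1)"
    using i assms(2) by (simp_all add: ent b'[simplified])
  show ?thesis
  proof (cases "i = 1")
    case True
    then show ?thesis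
      using x near far i assms(2)
      by (simp add: reduct_def oriented_mult_def numeral_2_eq_2)
  next
    case False
    then have "i - 1 \<in> {1..length a}" using i by auto
    then have "entry b (i - 1) = ?m (entry a (i - 1)) x'"
      using b'(3) assms(2) by (simp only: ent)
    then show ?thesis
      using x near far i assms(2) False
      by (cases "even i") (auto simp: reduct_def oriented_mult_def oriented_right_lcm)
  qed
qed

text \<open>Outside the range of the list a step can write only to position 0, at level 1, and there
  it writes 1 again. So the padding survives and \<open>h\<close> comes from a list.\<close>

lemma seq_reduct_entries:
  fixes a :: "'a::monoid_mult multifraction"
  assumes "seq_reduct (length a) i x (entries a) h"
  obtains b where "length b = length a" "entries b = h"
proof
  let ?b = "map (\<lambda>k. h (Suc k)) [0..<length a]"
  show "length ?b = length a" by simp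
  have "h k = 1" if "k \<notin> {1..length a}" for k
    using assms that unfolding seq_reduct_def by (auto simp: entries_def)
  then show "entries ?b = h"
    by (auto simp: entries_def entry_def fun_eq_iff)
qed

lemma seq_reducts_R_sys:
  fixes a :: "'a::gcd_monoid multifraction"
  assumes "(\<lambda>g h. \<exists>i x. seq_reduct n i x g h)\<^sup>*\<^sup>* g h" "g = entries a" "length a = n"
  shows "\<exists>b. length b = n \<and> entries b = h \<and> R_sys\<^sup>*\<^sup>* a b"
  using assms
proof (induction rule: rtranclp_induct)
  case base
  then show ?case by blast
next
  case (step h k)
  then obtain b where b: "length b = n" "entries b = h" "R_sys\<^sup>*\<^sup>* a b" by blast
  from step(2) obtain i x where s: "seq_reduct (length b) i x (entries b) k" using b by auto
  then obtain c where c: "length c = length b" "entries c = k" by (rule seq_reduct_entries)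
  show ?case
  proof (cases "x = 1")
    case True
    then show ?thesis using b s seq_reduct_1 by blast
  next
    case False
    then have "R_sys b c" using seq_reduct_imp_reduct s c unfolding R_sys_def by blast
    then show ?thesis using b c by (metis rtranclp.rtrancl_into_rtrancl)
  qed
qed

lemma R_sys_locally_confluent:
  fixes a :: "'a::gcd_monoid multifraction"
  assumes "noetherian TYPE('a)" "three_ore TYPE('a)" and "R_sys a b" "R_sys a c"
  shows "\<exists>d. R_sys\<^sup>*\<^sup>* b d \<and> R_sys\<^sup>*\<^sup>* c d"
proof -
  obtain i x j y where "reduct i x a b" "reduct j y a c"
    using assms(3,4) unfolding R_sys_def by blast
  then have len: "length b = length a" "length c = length a"
    and s: "seq_reduct (length a) i x (entries a) (entries b)"
      "seq_reduct (length a) j y (entries a) (entries c)"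
    using reduct_imp_seq_reduct by blast+
  obtain h where
    h: "(\<lambda>g h. \<exists>i x. seq_reduct (length a) i x g h)\<^sup>*\<^sup>* (entries b) h"
      "(\<lambda>g h. \<exists>i x. seq_reduct (length a) i x g h)\<^sup>*\<^sup>* (entries c) h"
    using seq_locally_confluent[OF assms(1,2) s] unfolding seq_joinable_def by blast
  obtain d where "length d = length a" "entries d = h" "R_sys\<^sup>*\<^sup>* b d"
    using seq_reducts_R_sys[OF h(1) refl len(1)] by blast
  moreover obtain d' where "length d' = length a" "entries d' = h" "R_sys\<^sup>*\<^sup>* c d'"
    using seq_reducts_R_sys[OF h(2) refl len(2)] by blast
  ultimately show ?thesis using entries_inject by metis
qed

text \<open>A step at the last level would split the final 1 into a product with the nontrivial
  factor \<open>x\<close>. At any lower level the final 1 is untouched.\<close>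

lemma R_sys_snoc_1D:
  fixes a :: "'a::gcd_monoid multifraction"
  assumes "R_sys (a @ [1]) b"
  obtains c where "b = c @ [1]" "R_sys a c"
proof -
  from assms obtain i x where x: "x \<noteq> 1" and red: "reduct i x (a @ [1]) b"
    unfolding R_sys_def by blast
  have len: "length b = Suc (length a)" and i: "1 \<le> i" "i \<le> length a"
    and far: "\<And>k. k \<in> {1..Suc (length a)} \<Longrightarrow> k \<notin> {i - 1, i, i + 1} \<Longrightarrow>
      entry b k = entry (a @ [1]) k"
    using red unfolding reduct_def by auto
  have last: "entry (a @ [1]) (Suc (length a)) = 1" by (simp add: entry_def)
  have "i \<noteq> length a"
  proof
    assume "i = length a"
    then have "x * entry b (i + 1) = 1 \<or> entry b (i + 1) * x = 1"
      using red last unfolding reduct_def by (auto simp: numeral_2_eq_2 split: if_splits)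
    then show False using x left_unit_eq_one right_unit_eq_one by blast
  qed
  then have i': "i < length a" using i by simp
  obtain c z where b: "b = c @ [z]" and c: "length c = length a"
    using len by (metis length_Suc_conv_rev)
  have "entry b (Suc (length a)) = 1" using far[of "Suc (length a)"] last i' by auto
  then have "z = 1" using b c by (simp add: entry_def nth_append)
  moreover have ent: "entry (a @ [1]) k = entry a k" "entry b k = entry c k"
    if "k \<le> length a" "0 < k" for k
    using that b c by (auto simp: entry_def nth_append)
  have "reduct i x a c"
    using red i i' c len unfolding reduct_def
    by (auto simp: ent numeral_2_eq_2 split: if_splits)
  ultimately show ?thesis using that x b unfolding R_sys_def by blast
qed

text \<open>Two removals coincide, and a removal and a step of \<open>R_sys\<close> are joined by
  performing the other one.\<close>

lemma R_hat_sys_locally_confluent: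
  fixes a :: "'a::gcd_monoid multifraction"
  assumes "noetherian TYPE('a)" "three_ore TYPE('a)" and "R_hat_sys a b" "R_hat_sys a c"
  shows "\<exists>d. R_hat_sys\<^sup>*\<^sup>* b d \<and> R_hat_sys\<^sup>*\<^sup>* c d"
proof -
  have commute: "\<exists>d. R_hat_sys\<^sup>*\<^sup>* b d \<and> R_hat_sys\<^sup>*\<^sup>* c d"
    if "R_sys a b" "a = c @ [1]" for b c
  proof -
    obtain d where "b = d @ [1]" "R_sys c d" using R_sys_snoc_1D \<open>R_sys a b\<close> \<open>a = c @ [1]\<close> by blast
    then have "R_hat_sys b d" "R_hat_sys c d" unfolding R_hat_sys_def by auto
    then show ?thesis by blast
  qed
  have lift: "R_hat_sys\<^sup>*\<^sup>* u v" if "R_sys\<^sup>*\<^sup>* u v" for u v :: "'a list"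
    using that by (rule rtranclp_mono[THEN predicate2D, rotated]) (auto simp: R_hat_sys_def)
  show ?thesis
    using assms(3,4) R_sys_locally_confluent[OF assms(1,2), of a b c] commute lift
    unfolding R_hat_sys_def[of a] by blast
qed

section \<open>Termination and convergence\<close>

text \<open>A step at level \<open>i\<close> fixes all entries beyond \<open>i + 1\<close> and replaces entry \<open>i + 1\<close> by a proper
  divisor, on a side determined by the parity of \<open>i\<close>. So multifractions decrease
  lexicographically when read from the right.\<close>

definition divisor_order :: "((bool \<times> 'a::times) \<times> bool \<times> 'a) set" where
  "divisor_order = {((e, a), e', b). e = e' \<and> (if e then left_dvd a b else right_dvd a b) \<and> a \<noteq> b}"

text \<open>Reversal makes the lexicographic comparison start from the right; the tag keeps the
  parity of the position, which selects the side of divisibility.\<close>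

definition tagged_rev :: "'a multifraction \<Rightarrow> (bool \<times> 'a) list" where
  "tagged_rev a = rev (map (\<lambda>k. (even k, entry a k)) [1..<Suc (length a)])"

lemma wf_divisor_order:
  assumes "noetherian TYPE('a::monoid_mult)"
  shows "wf (divisor_order :: ((bool \<times> 'a) \<times> bool \<times> 'a) set)"
proof -
  have wf: "wf {(a, b :: 'a). left_dvd a b \<and> a \<noteq> b}" "wf {(a, b :: 'a). right_dvd a b \<and> a \<noteq> b}"
    using assms unfolding noetherian_def wfp_def by simp_all
  have step: "P (e, b)"
    if "\<And>x. (\<And>y. (y, x) \<in> divisor_order \<Longrightarrow> P y) \<Longrightarrow> P x"
    for P :: "bool \<times> 'a \<Rightarrow> bool" and e b
  proof (cases e)
    case True
    from wf(1) have "P (True, b)"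
      by (induction b rule: wf_induct_rule) (rule that, auto simp: divisor_order_def)
    with True show ?thesis by simp
  next
    case False
    from wf(2) have "P (False, b)"
      by (induction b rule: wf_induct_rule) (rule that, auto simp: divisor_order_def)
    with False show ?thesis by simp
  qed
  show ?thesis
    unfolding wf_def
  proof (intro allI impI)
    fix P :: "bool \<times> 'a \<Rightarrow> bool" and x
    assume *: "\<forall>x. (\<forall>y. (y, x) \<in> divisor_order \<longrightarrow> P y) \<longrightarrow> P x"
    have "P (fst x, snd x)" by (rule step[of P]) (use * in blast)
    then show "P x" by simp
  qed
qed

lemma R_sys_decreases:
  fixes a :: "'a::gcd_monoid multifraction"
  assumes "R_sys a b"
  shows "(tagged_rev b, tagged_rev a) \<in> lenlex divisor_order"
proof -
  from assms obtain i x where x: "x \<noteq> 1" and red: "reduct i x a b"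
    unfolding R_sys_def by blast
  have i: "1 \<le> i" "i < length a" and len: "length b = length a"
    using red unfolding reduct_def by auto
  let ?t = "\<lambda>c k. (even k, entry c k)"
  have split: "[1..<Suc (length a)] = [1..<Suc i] @ Suc i # [Suc (Suc i)..<Suc (length a)]"
    using i upt_add_eq_append[of 1 "Suc i" "length a - i"] upt_conv_Cons[of "Suc i" "Suc (length a)"]
    by simp
  define xs where "xs = rev (map (?t a) [Suc (Suc i)..<Suc (length a)])"
  have "map (?t b) [Suc (Suc i)..<Suc (length a)] = map (?t a) [Suc (Suc i)..<Suc (length a)]"
    using red unfolding reduct_def by auto
  then have
    "tagged_rev a = xs @ ?t a (Suc i) # rev (map (?t a) [1..<Suc i])"
    "tagged_rev b = xs @ ?t b (Suc i) # rev (map (?t b) [1..<Suc i])"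
    unfolding tagged_rev_def len split xs_def by (simp_all del: upt_Suc)
  \<comment> \<open>Position \<open>i + 1\<close> has the parity opposite to \<open>i\<close>, so
    even levels are compared by right divisibility; cancellation and \<open>x \<noteq> 1\<close>
    make the divisor proper.\<close>
  moreover have "(?t b (Suc i), ?t a (Suc i)) \<in> divisor_order"
  proof (cases "even i")
    case True
    then have *: "x * entry b (Suc i) = entry a (Suc i)"
      using red unfolding reduct_def by (auto split: if_splits)
    then have "right_dvd (entry b (Suc i)) (entry a (Suc i))"
      unfolding right_dvd_def by metis
    moreover have "entry b (Suc i) \<noteq> entry a (Suc i)"
      using * x mult_right_cancel[of x "entry b (Suc i)" 1] by auto
    ultimately show ?thesis using True by (simp add: divisor_order_def)
  next
    case False
    then have *: "entry b (Suc i) * x = entry a (Suc i)"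
      using red unfolding reduct_def by (auto simp: numeral_2_eq_2 split: if_splits)
    then have "left_dvd (entry b (Suc i)) (entry a (Suc i))"
      unfolding left_dvd_def by metis
    moreover have "entry b (Suc i) \<noteq> entry a (Suc i)"
      using * x mult_left_cancel[of "entry b (Suc i)" x 1] by auto
    ultimately show ?thesis using False by (simp add: divisor_order_def)
  qed
  ultimately show ?thesis
    by (simp add: lenlex_conv lex_append_leftI del: upt_Suc)
qed

text \<open>A removal shortens the list, and \<open>lenlex\<close> compares lengths first.\<close>

lemma R_hat_sys_decreases:
  fixes a :: "'a::gcd_monoid multifraction"
  assumes "R_hat_sys a b"
  shows "(tagged_rev b, tagged_rev a) \<in> lenlex divisor_order"
  using assms R_sys_decreases unfolding R_hat_sys_def
  by (auto simp: lenlex_conv tagged_rev_def simp del: upt_Suc)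

text \<open>Termination comes from the measure \<open>f\<close>, uniqueness from Newman's
  argument.\<close>

lemma convergent_system_if_locally_confluent:
  assumes wf: "wf R" and dec: "\<And>a b. r a b \<Longrightarrow> (f b, f a) \<in> R"
    and conf: "\<And>a b c. r a b \<Longrightarrow> r a c \<Longrightarrow> \<exists>d. r\<^sup>*\<^sup>* b d \<and> r\<^sup>*\<^sup>* c d"
  shows "convergent_system r"
proof -
  have wf': "wf {(b, a). r a b}"
    by (rule wf_subset[OF wf_inv_image[OF wf, of f]]) (auto intro: dec)
  \<comment> \<open>The induction runs along the transitive closure, since its hypothesis is applied
    to \<open>d\<close>, possibly several steps below \<open>a\<close>.\<close>
  have "\<exists>!b. r\<^sup>*\<^sup>* a b \<and> irreducible_for r b" for a
    using wf_trancl[OF wf']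
  proof (induction a rule: wf_induct_rule)
    case (less a)
    show ?case
    proof (cases "irreducible_for r a")
      case True
      then show ?thesis unfolding irreducible_for_def by (blast elim: converse_rtranclpE)
    next
      case False
      then obtain b where b: "r a b" unfolding irreducible_for_def by blast
      with less obtain n where n: "r\<^sup>*\<^sup>* b n" "irreducible_for r n" by blast
      have "m = n" if m: "r\<^sup>*\<^sup>* a m" "irreducible_for r m" for m
      proof -
        obtain c where c: "r a c" "r\<^sup>*\<^sup>* c m"
          using m False by (metis converse_rtranclpE)
        obtain d where d: "r\<^sup>*\<^sup>* b d" "r\<^sup>*\<^sup>* c d" using conf b c by blast
        have "(d, a) \<in> {(b, a). r a b}\<^sup>+"
          using d(1)
          by (induction rule: rtranclp_induct) (use b in \<open>auto intro: trancl_into_trancl2\<close>)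
        \<comment> \<open>An irreducible reduct of \<open>d\<close> is one of both \<open>b\<close>
          and \<open>c\<close>, so uniqueness for \<open>b\<close> and \<open>c\<close> identifies
          it with \<open>n\<close> and with \<open>m\<close>.\<close>
        then obtain k where k: "r\<^sup>*\<^sup>* d k" "irreducible_for r k" using less[of d] by blast
        then have "r\<^sup>*\<^sup>* b k" "r\<^sup>*\<^sup>* c k" using d by auto
        then show ?thesis using less[of b] less[of c] b c n m k by blast
      qed
      then show ?thesis
        using b n by (intro ex1I[of _ n]) (auto intro: converse_rtranclp_into_rtranclp)
    qed
  qed
  then show ?thesis
    using wf' unfolding convergent_system_def wf_iff_no_infinite_down_chain by auto
qed

theorem proposition4p16:
  assumes "noetherian TYPE('a::gcd_monoid)"
    and "three_ore TYPE('a)"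
  shows "convergent_system (R_sys :: 'a multifraction \<Rightarrow> 'a multifraction \<Rightarrow> bool) \<and>
         convergent_system (R_hat_sys :: 'a multifraction \<Rightarrow> 'a multifraction \<Rightarrow> bool)"
proof -
  have wf: "wf (lenlex (divisor_order :: ((bool \<times> 'a) \<times> bool \<times> 'a) set))"
    by (rule wf_lenlex[OF wf_divisor_order[OF assms(1)]])
  show ?thesis
    using convergent_system_if_locally_confluent[OF wf R_sys_decreases
        R_sys_locally_confluent[OF assms]]
      convergent_system_if_locally_confluent[OF wf R_hat_sys_decreases
        R_hat_sys_locally_confluent[OF assms]]
    by (rule conjI)
qed

end
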